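(* Let $G$ be a cograph and let $T_G$ be a reduced cotree of $G$. Let $A=K_2\cup K_1$. Then $G$ is perfectly well-ve-dominated if and only if every join node $u$ of $T_G$ satisfies the following two conditions: (1) for every child $v$ of $u$, the graph $G_v$ is $2K_2$-free; (2) at most one child $v$ of $u$ has the property that $G_v$ contains an induced copy of $A$.
   Context: All graphs are finite, simple and undirected. A vertex $v$ ve-dominates an edge $e$ if at least one endpoint of $e$ belongs to the closed neighborhood $N_G[v]$. A set $D\subseteq V(G)$ is a ve-dominating set if every edge of $G$ is ve-dominated by some vertex of $D$; it is minimal if no proper subset is ve-dominating. $G$ is well-ve-dominated if all its minimal ve-dominating sets have the same cardinality, and perfectly well-ve-dominated if every induced subgraph of $G$ is well-ve-dominated. A cograph is a graph with no induced path $P_4$ on four vertices. A cotree of a cograph $G$ is a rooted tree whose leaves are the vertices of $G$ and whose internal nodes are labeled by disjoint union (union nodes) or join (join nodes); for a node $u$, $G_u$ denotes the subgraph of $G$ induced by the leaves in the subtree rooted at $u$, and for an internal node $u$, $G_u$ is the disjoint union or the join, according to the label of $u$, of the graphs $G_v$ over the children $v$ of $u$ (the join of graphs is their disjoint union together with all edges between distinct parts); the root $r$ satisfies $G_r=G$. A reduced cotree is one in which every internal node has at least two children and adjacent internal nodes have different labels. $K_n$ is the complete graph on $n$ vertices, $\cup$ denotes disjoint union, $2K_2$ is the disjoint union of two copies of $K_2$, and a graph is $H$-free if it has no induced subgraph isomorphic to $H$. *)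

theory Defs
  imports Main
begin

datatype 'a graph = Graph (verts: "'a set") (edges: "'a set set")

definition simple_graph :: "'a graph \<Rightarrow> bool" where
  "simple_graph G \<longleftrightarrow> finite (verts G) \<and> (\<forall>e \<in> edges G. e \<subseteq> verts G \<and> card e = 2)"

definition induced_subgraph :: "'a graph \<Rightarrow> 'a set \<Rightarrow> 'a graph" where
  "induced_subgraph G S = Graph (verts G \<inter> S) {e \<in> edges G. e \<subseteq> S}"

definition graph_iso :: "'a graph \<Rightarrow> 'b graph \<Rightarrow> bool" where
  "graph_iso G H \<longleftrightarrow>
     (\<exists>f. bij_betw f (verts G) (verts H) \<and> (\<lambda>e. f ` e) ` edges G = edges H)"

definition contains_induced :: "'a graph \<Rightarrow> 'b graph \<Rightarrow> bool" where
  "contains_induced G H \<longleftrightarrow> (\<exists>S \<subseteq> verts G. graph_iso (induced_subgraph G S) H)"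

definition induced_free :: "'b graph \<Rightarrow> 'a graph \<Rightarrow> bool" where
  "induced_free H G \<longleftrightarrow> \<not> contains_induced G H"

definition complete_graph :: "nat \<Rightarrow> nat graph" where
  "complete_graph n = Graph {..<n} {{i, j} | i j. i < n \<and> j < n \<and> i \<noteq> j}"

definition path_graph :: "nat \<Rightarrow> nat graph" where
  "path_graph n = Graph {..<n} {{i, Suc i} | i. Suc i < n}"

definition disjoint_union :: "'a graph \<Rightarrow> 'b graph \<Rightarrow> ('a + 'b) graph" where
  "disjoint_union G H =
     Graph (verts G <+> verts H) ((\<lambda>e. Inl ` e) ` edges G \<union> (\<lambda>e. Inr ` e) ` edges H)"

definition cograph :: "'a graph \<Rightarrow> bool" where
  "cograph G \<longleftrightarrow> induced_free (path_graph 4) G"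


definition closed_neighborhood :: "'a graph \<Rightarrow> 'a \<Rightarrow> 'a set" where
  "closed_neighborhood G v = insert v {w \<in> verts G. {v, w} \<in> edges G}"

definition ve_dominates :: "'a graph \<Rightarrow> 'a \<Rightarrow> 'a set \<Rightarrow> bool" where
  "ve_dominates G v e \<longleftrightarrow> (\<exists>x \<in> e. x \<in> closed_neighborhood G v)"

definition ve_dominating_set :: "'a graph \<Rightarrow> 'a set \<Rightarrow> bool" where
  "ve_dominating_set G D \<longleftrightarrow>
     D \<subseteq> verts G \<and> (\<forall>e \<in> edges G. \<exists>v \<in> D. ve_dominates G v e)"

definition minimal_ve_dominating_set :: "'a graph \<Rightarrow> 'a set \<Rightarrow> bool" where
  "minimal_ve_dominating_set G D \<longleftrightarrow>
     ve_dominating_set G D \<and> (\<forall>D'. D' \<subset> D \<longrightarrow> \<not> ve_dominating_set G D')"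

definition well_ve_dominated :: "'a graph \<Rightarrow> bool" where
  "well_ve_dominated G \<longleftrightarrow>
     (\<forall>D D'. minimal_ve_dominating_set G D \<longrightarrow> minimal_ve_dominating_set G D' \<longrightarrow>
        card D = card D')"

definition perfectly_well_ve_dominated :: "'a graph \<Rightarrow> bool" where
  "perfectly_well_ve_dominated G \<longleftrightarrow>
     (\<forall>S \<subseteq> verts G. well_ve_dominated (induced_subgraph G S))"


datatype label = UnionNode | JoinNode

text \<open>
  Rooted trees with labelled internal nodes. The children of a node are kept in a list, whose order
  is never used. In a cotree the leaves are pairwise distinct and every internal node has a child,
  so different nodes root different subtrees; a node is therefore identified with its subtree.
\<close>

datatype 'a cotree = Leaf 'a | Node label "'a cotree list"

primrec leaf_list :: "'a cotree \<Rightarrow> 'a list" where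
  "leaf_list (Leaf a) = [a]"
| "leaf_list (Node l ts) = concat (map leaf_list ts)"

primrec subtrees :: "'a cotree \<Rightarrow> 'a cotree set" where
  "subtrees (Leaf a) = {Leaf a}"
| "subtrees (Node l ts) = insert (Node l ts) (\<Union> (set (map subtrees ts)))"

definition node_graph :: "'a graph \<Rightarrow> 'a cotree \<Rightarrow> 'a graph" where
  "node_graph G u = induced_subgraph G (set (leaf_list u))"

text \<open>
  The next two operations are only applied to graphs with pairwise disjoint vertex sets, where they
  are the disjoint union and the join without any renaming of vertices.
\<close>

definition union_graphs :: "'a graph list \<Rightarrow> 'a graph" where
  "union_graphs Gs = Graph (\<Union> (verts ` set Gs)) (\<Union> (edges ` set Gs))"

definition join_graphs :: "'a graph list \<Rightarrow> 'a graph" where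
  "join_graphs Gs = Graph (\<Union> (verts ` set Gs))
     (\<Union> (edges ` set Gs) \<union>
      {{x, y} | x y. \<exists>i < length Gs. \<exists>j < length Gs.
                       i \<noteq> j \<and> x \<in> verts (Gs ! i) \<and> y \<in> verts (Gs ! j)})"

fun combine_graphs :: "label \<Rightarrow> 'a graph list \<Rightarrow> 'a graph" where
  "combine_graphs UnionNode Gs = union_graphs Gs"
| "combine_graphs JoinNode Gs = join_graphs Gs"

definition is_cotree :: "'a cotree \<Rightarrow> 'a graph \<Rightarrow> bool" where
  "is_cotree T G \<longleftrightarrow>
     distinct (leaf_list T) \<and> set (leaf_list T) = verts G \<and>
     (\<forall>l ts. Node l ts \<in> subtrees T \<longrightarrow>
        ts \<noteq> [] \<and> node_graph G (Node l ts) = combine_graphs l (map (node_graph G) ts))"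

definition reduced_cotree :: "'a cotree \<Rightarrow> 'a graph \<Rightarrow> bool" where
  "reduced_cotree T G \<longleftrightarrow>
     is_cotree T G \<and>
     (\<forall>l ts. Node l ts \<in> subtrees T \<longrightarrow>
        length ts \<ge> 2 \<and> (\<forall>l' ts'. Node l' ts' \<in> set ts \<longrightarrow> l' \<noteq> l))"

definition two_K2 :: "(nat + nat) graph" where
  "two_K2 = disjoint_union (complete_graph 2) (complete_graph 2)"

definition graph_A :: "(nat + nat) graph" where
  "graph_A = disjoint_union (complete_graph 2) (complete_graph 1)"

end

theory Submission
  imports Defs
begin

text \<open>
  Two graphs obstruct perfect well-ve-domination: the butterfly, which is the join of
  \<open>2K\<^sub>2\<close> with a single vertex, and the join of two copies of \<open>A\<close>. Each is ve-dominated by a single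
  vertex, but also has a minimal ve-dominating set of size two: one vertex from each \<open>K\<^sub>2\<close>, or
  the isolated vertices of the two copies of \<open>A\<close>.

  Conversely, a cograph without these two induced subgraphs is perfectly well-ve-dominated
  (\<open>perfectly_well_ve_dominatedI\<close>). The heart of the matter is \<open>dominated_edges_nested\<close>: the sets
  of edges ve-dominated by two vertices of one component are comparable under inclusion, since two
  edges witnessing the contrary lead to one of the obstructions.
  Hence a minimal ve-dominating set has at most one vertex in each component, and therefore exactly
  one in each component that has an edge; all such sets have the same size.

  It remains to find the obstructions in the cotree. An obstruction is connected, so the
  lowest node of the cotree whose leaves include all of it is a join node, and the co-components
  of the obstruction are spread over at least two children of that node. The co-components of the
  butterfly are \<open>2K\<^sub>2\<close> and a single vertex, which yields a violation of the first condition; those of the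
  other obstruction are the two copies of \<open>A\<close>, which yields a violation of the second. In the opposite
  direction a join node supplies the missing join edges, as it has at least two children.
\<close>

section \<open>Adjacency and induced copies\<close>

definition adj :: "'a graph \<Rightarrow> 'a \<Rightarrow> 'a \<Rightarrow> bool" where
  "adj G x y \<longleftrightarrow> {x, y} \<in> edges G"

lemma adj_commute: "adj G x y \<longleftrightarrow> adj G y x"
  by (simp add: adj_def insert_commute)

lemma adj_neq: "simple_graph G \<Longrightarrow> adj G x y \<Longrightarrow> x \<noteq> y"
  by (fastforce simp: adj_def simple_graph_def)

lemma adj_verts: "simple_graph G \<Longrightarrow> adj G x y \<Longrightarrow> x \<in> verts G \<and> y \<in> verts G"
  by (auto simp: adj_def simple_graph_def)

lemma edge_cases:
  assumes "simple_graph G" "e \<in> edges G"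
  obtains x y where "e = {x, y}" "adj G x y"
  using assms by (auto simp: adj_def simple_graph_def card_2_iff)

lemma verts_induced_subgraph [simp]: "verts (induced_subgraph G S) = verts G \<inter> S"
  by (simp add: induced_subgraph_def)

lemma adj_induced_subgraph [simp]:
  "adj (induced_subgraph G S) x y \<longleftrightarrow> adj G x y \<and> x \<in> S \<and> y \<in> S"
  by (auto simp: induced_subgraph_def adj_def)

lemma simple_induced_subgraph: "simple_graph G \<Longrightarrow> simple_graph (induced_subgraph G S)"
  by (auto simp: induced_subgraph_def simple_graph_def)

text \<open>
  An isomorphism from an induced subgraph of \<open>G\<close> onto \<open>H\<close> is inverted to an embedding of
  \<open>H\<close> into \<open>G\<close>, which for a concrete \<open>H\<close> is just a choice of finitely many vertices.
\<close>

lemma contains_induced_iff_embedding: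
  assumes G: "simple_graph G" and H: "simple_graph H"
  shows "contains_induced G H \<longleftrightarrow>
    (\<exists>g. inj_on g (verts H) \<and> g ` verts H \<subseteq> verts G \<and>
         (\<forall>x \<in> verts H. \<forall>y \<in> verts H. adj G (g x) (g y) \<longleftrightarrow> adj H x y))"
    (is "?L \<longleftrightarrow> ?R")
proof
  assume ?L
  then obtain S f where S: "S \<subseteq> verts G"
    and f: "bij_betw f (verts (induced_subgraph G S)) (verts H)"
    and E: "(\<lambda>e. f ` e) ` edges (induced_subgraph G S) = edges H"
    by (auto simp: contains_induced_def graph_iso_def)
  from S have vS: "verts (induced_subgraph G S) = S" by auto
  with f have f: "bij_betw f S (verts H)" by simp
  define g where "g = inv_into S f"
  have g: "bij_betw g (verts H) S" using f by (simp add: g_def bij_betw_inv_into)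
  have fg: "f (g x) = x" if "x \<in> verts H" for x
    using f that by (simp add: g_def bij_betw_inv_into_right)
  have gS: "g x \<in> S" if "x \<in> verts H" for x using g that by (auto simp: bij_betw_def)
  have "adj G (g x) (g y) \<longleftrightarrow> adj H x y" if x: "x \<in> verts H" and y: "y \<in> verts H" for x y
  proof
    assume "adj G (g x) (g y)"
    then have "{g x, g y} \<in> edges (induced_subgraph G S)"
      using gS[OF x] gS[OF y] by (simp add: adj_def induced_subgraph_def)
    then have "f ` {g x, g y} \<in> edges H" using E by blast
    then show "adj H x y" using fg[OF x] fg[OF y] by (simp add: adj_def)
  next
    assume "adj H x y"
    then obtain e where e: "e \<in> edges (induced_subgraph G S)" "f ` e = {x, y}"
      unfolding adj_def E[symmetric] by (metis imageE)
    then have eG: "e \<in> edges G" and eS: "e \<subseteq> S" by (auto simp: induced_subgraph_def)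
    have "g ` f ` e = e"
      using eS f by (force simp: g_def bij_betw_def image_image intro: inv_into_f_f)
    then show "adj G (g x) (g y)" using e(2) eG by (simp add: adj_def)
  qed
  then show ?R using g S by (auto simp: bij_betw_def)
next
  assume ?R
  then obtain g where inj: "inj_on g (verts H)" and gV: "g ` verts H \<subseteq> verts G"
    and A: "\<forall>x \<in> verts H. \<forall>y \<in> verts H. adj G (g x) (g y) \<longleftrightarrow> adj H x y"
    by (elim exE conjE)
  define f where "f = inv_into (verts H) g"
  have bij: "bij_betw f (g ` verts H) (verts H)"
    using inj by (simp add: f_def bij_betw_inv_into inj_on_imp_bij_betw)
  have fg: "f (g x) = x" if "x \<in> verts H" for x using inj that by (simp add: f_def)
  have "(\<lambda>e. f ` e) ` edges (induced_subgraph G (g ` verts H)) = edges H"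
  proof (intro equalityI subsetI)
    fix e assume "e \<in> (\<lambda>e. f ` e) ` edges (induced_subgraph G (g ` verts H))"
    then obtain d where d: "d \<in> edges (induced_subgraph G (g ` verts H))" "e = f ` d" by blast
    from simple_induced_subgraph[OF G] d(1)
    obtain x y where xy: "d = {x, y}" "adj (induced_subgraph G (g ` verts H)) x y"
      by (rule edge_cases)
    then obtain x' y' where "x' \<in> verts H" "y' \<in> verts H" "x = g x'" "y = g y'" by auto
    moreover from this have "adj H x' y'" using xy A by simp
    ultimately show "e \<in> edges H" using xy fg d(2) by (simp add: adj_def)
  next
    fix e assume "e \<in> edges H"
    with H obtain x y where xy: "e = {x, y}" "adj H x y" by (rule edge_cases)
    then have v: "x \<in> verts H" "y \<in> verts H" using adj_verts[OF H] by auto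
    then have "adj (induced_subgraph G (g ` verts H)) (g x) (g y)" using A xy(2) by simp
    then have "f ` {g x, g y} \<in> (\<lambda>e. f ` e) ` edges (induced_subgraph G (g ` verts H))"
      unfolding adj_def by (rule imageI)
    then show "e \<in> (\<lambda>e. f ` e) ` edges (induced_subgraph G (g ` verts H))"
      using xy(1) fg v by simp
  qed
  moreover have "verts (induced_subgraph G (g ` verts H)) = g ` verts H" using gV by auto
  ultimately show ?L unfolding contains_induced_def graph_iso_def using gV bij by metis
qed

lemma simple_path_graph: "simple_graph (path_graph n)"
  by (auto simp: simple_graph_def path_graph_def)

lemma adj_path_graph: "adj (path_graph n) i j \<longleftrightarrow> i < n \<and> j < n \<and> (j = Suc i \<or> i = Suc j)"
  by (auto simp: adj_def path_graph_def doubleton_eq_iff)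

lemma simple_complete_graph: "simple_graph (complete_graph n)"
  by (auto simp: simple_graph_def complete_graph_def card_2_iff)

lemma adj_complete_graph: "adj (complete_graph n) i j \<longleftrightarrow> i < n \<and> j < n \<and> i \<noteq> j"
  by (auto simp: adj_def complete_graph_def doubleton_eq_iff)

lemma simple_disjoint_union:
  assumes "simple_graph G" "simple_graph H" shows "simple_graph (disjoint_union G H)"
  using assms by (fastforce simp: simple_graph_def disjoint_union_def card_image)

lemma doubleton_eq_image_iff:
  assumes "inj f"
  shows "{p, q} = f ` e \<longleftrightarrow> (\<exists>x y. p = f x \<and> q = f y \<and> e = {x, y})"
proof
  assume eq: "{p, q} = f ` e"
  then obtain x y where xy: "p = f x" "q = f y" by (metis imageE insertI1 insertI2)
  then have "f ` e = f ` {x, y}" using eq by simp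
  then have "e = {x, y}" using assms by (simp only: inj_image_eq_iff)
  then show "\<exists>x y. p = f x \<and> q = f y \<and> e = {x, y}" using xy by blast
qed auto

lemma adj_disjoint_union:
  "adj (disjoint_union G H) p q \<longleftrightarrow>
     (\<exists>x y. p = Inl x \<and> q = Inl y \<and> adj G x y) \<or> (\<exists>x y. p = Inr x \<and> q = Inr y \<and> adj H x y)"
proof -
  have "adj (disjoint_union G H) p q \<longleftrightarrow>
      (\<exists>e \<in> edges G. {p, q} = Inl ` e) \<or> (\<exists>e \<in> edges H. {p, q} = Inr ` e)"
    by (auto simp: adj_def disjoint_union_def)
  then show ?thesis
    unfolding doubleton_eq_image_iff[OF inj_Inl] doubleton_eq_image_iff[OF inj_Inr] adj_def
    by blast
qed

text \<open>
  The vertices in the next two definitions are distinct in a simple graph: a coincidence would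
  make a vertex adjacent to itself, or some pair both adjacent and non-adjacent.
\<close>

definition A_copy :: "'a graph \<Rightarrow> 'a \<Rightarrow> 'a \<Rightarrow> 'a \<Rightarrow> bool" where
  "A_copy G x y d \<longleftrightarrow> adj G x y \<and> d \<in> verts G \<and> \<not> adj G d x \<and> \<not> adj G d y"

definition two_K2_copy :: "'a graph \<Rightarrow> 'a \<Rightarrow> 'a \<Rightarrow> 'a \<Rightarrow> 'a \<Rightarrow> bool" where
  "two_K2_copy G a a' b b' \<longleftrightarrow> adj G a a' \<and> adj G b b' \<and>
     \<not> adj G a b \<and> \<not> adj G a b' \<and> \<not> adj G a' b \<and> \<not> adj G a' b'"

text \<open>
  The form in which the absence of an induced path is used: a walk \<open>a b c d\<close> in which neither
  \<open>a c\<close> nor \<open>b d\<close> is an edge starts and ends at equal or adjacent vertices.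
\<close>

lemma P4_free_cographD:
  assumes G: "simple_graph G" and "cograph G"
    and e: "adj G a b" "adj G b c" "adj G c d" and n: "\<not> adj G a c" "\<not> adj G b d"
  shows "a = d \<or> adj G a d"
proof (rule ccontr)
  assume *: "\<not> (a = d \<or> adj G a d)"
  define g where "g = (\<lambda>i::nat. [a, b, c, d] ! i)"
  have v: "verts (path_graph 4) = {0, 1, 2, 3}" by (auto simp: path_graph_def)
  have gs: "g 0 = a" "g (Suc 0) = b" "g 2 = c" "g 3 = d" by (simp_all add: g_def)
  have d: "a \<noteq> b" "b \<noteq> c" "c \<noteq> d" using adj_neq[OF G] e by blast+
  have "a \<noteq> c" "b \<noteq> d" using * e n by (metis adj_commute)+
  then have "inj_on g (verts (path_graph 4))" using * d by (auto simp: v inj_on_def gs)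
  moreover have "g ` verts (path_graph 4) \<subseteq> verts G" using adj_verts[OF G] e by (auto simp: v gs)
  moreover have "adj G (g i) (g j) \<longleftrightarrow> adj (path_graph 4) i j"
    if "i \<in> verts (path_graph 4)" "j \<in> verts (path_graph 4)" for i j
  proof -
    have "\<not> adj G d a" "\<not> adj G c a" "\<not> adj G d b" "adj G b a" "adj G c b" "adj G d c"
      using * e n adj_commute[of G] by blast+
    moreover have "\<not> adj G p p" for p using adj_neq[OF G] by blast
    ultimately show ?thesis
      using that * e n unfolding v adj_path_graph by (elim insertE emptyE) (simp_all add: gs)
  qed
  ultimately have "contains_induced G (path_graph 4)"
    by (intro contains_induced_iff_embedding[OF G simple_path_graph, THEN iffD2] exI[of _ g] conjI ballI)
  with \<open>cograph G\<close> show False by (simp add: cograph_def induced_free_def)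
qed

lemma contains_two_K2_iff:
  assumes G: "simple_graph G"
  shows "contains_induced G two_K2 \<longleftrightarrow> (\<exists>a a' b b'. two_K2_copy G a a' b b')" (is "?L \<longleftrightarrow> ?R")
proof -
  have v: "verts two_K2 = {Inl 0, Inl 1, Inr 0, Inr 1}"
    by (auto simp: two_K2_def disjoint_union_def complete_graph_def)
  have s: "simple_graph two_K2"
    by (simp add: two_K2_def simple_disjoint_union simple_complete_graph)
  have e: "adj two_K2 (Inl i) (Inr j) \<longleftrightarrow> False" "adj two_K2 (Inr i) (Inl j) \<longleftrightarrow> False"
    "adj two_K2 (Inl i) (Inl j) \<longleftrightarrow> i < 2 \<and> j < 2 \<and> i \<noteq> j"
    "adj two_K2 (Inr i) (Inr j) \<longleftrightarrow> i < 2 \<and> j < 2 \<and> i \<noteq> j" for i j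
    by (simp_all add: two_K2_def adj_disjoint_union adj_complete_graph)
  note iff = contains_induced_iff_embedding[OF G s, unfolded v]
  show ?thesis
  proof
    assume ?L
    then show ?R unfolding iff two_K2_copy_def by (auto simp: e)
  next
    assume ?R
    then obtain a a' b b' where *: "adj G a a'" "adj G b b'"
      "\<not> adj G a b" "\<not> adj G a b'" "\<not> adj G a' b" "\<not> adj G a' b'"
      by (auto simp: two_K2_copy_def)
    define g where "g = case_sum (\<lambda>i::nat. if i = 0 then a else a') (\<lambda>i::nat. if i = 0 then b else b')"
    have "a \<noteq> a'" "b \<noteq> b'" using adj_neq[OF G] * by blast+
    moreover have "a \<noteq> b" "a \<noteq> b'" "a' \<noteq> b" "a' \<noteq> b'" using * by (metis adj_commute)+
    ultimately have "inj_on g {Inl 0, Inl 1, Inr 0, Inr 1}" by (auto simp: inj_on_def g_def)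
    moreover have "g ` {Inl 0, Inl 1, Inr 0, Inr 1} \<subseteq> verts G"
      using adj_verts[OF G] * by (auto simp: g_def)
    ultimately show ?L unfolding iff
      using * adj_neq[OF G] adj_commute[of G] by (intro exI[of _ g]) (auto simp: g_def e)
  qed
qed

lemma contains_graph_A_iff:
  assumes G: "simple_graph G"
  shows "contains_induced G graph_A \<longleftrightarrow> (\<exists>x y d. A_copy G x y d)" (is "?L \<longleftrightarrow> ?R")
proof -
  have v: "verts graph_A = {Inl 0, Inl 1, Inr 0}"
    by (auto simp: graph_A_def disjoint_union_def complete_graph_def)
  have s: "simple_graph graph_A"
    by (simp add: graph_A_def simple_disjoint_union simple_complete_graph)
  have e: "adj graph_A (Inl i) (Inr j) \<longleftrightarrow> False" "adj graph_A (Inr i) (Inl j) \<longleftrightarrow> False"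
    "adj graph_A (Inl i) (Inl j) \<longleftrightarrow> i < 2 \<and> j < 2 \<and> i \<noteq> j"
    "adj graph_A (Inr i) (Inr j) \<longleftrightarrow> i < 1 \<and> j < 1 \<and> i \<noteq> j" for i j
    by (simp_all add: graph_A_def adj_disjoint_union adj_complete_graph)
  note iff = contains_induced_iff_embedding[OF G s, unfolded v]
  show ?thesis
  proof
    assume ?L
    then show ?R unfolding iff A_copy_def by (auto simp: e)
  next
    assume ?R
    then obtain x y d where *: "adj G x y" "d \<in> verts G" "\<not> adj G d x" "\<not> adj G d y"
      by (auto simp: A_copy_def)
    define g where "g = case_sum (\<lambda>i::nat. if i = 0 then x else y) (\<lambda>i::nat. d)"
    have "x \<noteq> y" using adj_neq[OF G] * by blast
    moreover have "x \<noteq> d" "y \<noteq> d" using * by (metis adj_commute)+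
    ultimately have "inj_on g {Inl 0, Inl 1, Inr 0}" by (auto simp: inj_on_def g_def)
    moreover have "g ` {Inl 0, Inl 1, Inr 0} \<subseteq> verts G"
      using adj_verts[OF G] * by (auto simp: g_def)
    ultimately show ?L unfolding iff
      using * adj_neq[OF G] adj_commute[of G] by (intro exI[of _ g]) (auto simp: g_def e)
  qed
qed


section \<open>Ve-domination and the two obstructions\<close>

definition vdom :: "'a graph \<Rightarrow> 'a \<Rightarrow> 'a \<Rightarrow> 'a \<Rightarrow> bool" where
  "vdom G v x y \<longleftrightarrow> v = x \<or> v = y \<or> adj G v x \<or> adj G v y"

lemma ve_dominating_set_iff:
  assumes "simple_graph G"
  shows "ve_dominating_set G D \<longleftrightarrow>
     D \<subseteq> verts G \<and> (\<forall>x y. adj G x y \<longrightarrow> (\<exists>v \<in> D. vdom G v x y))"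
proof -
  have "ve_dominates G v {x, y} \<longleftrightarrow> vdom G v x y" if "adj G x y" for v x y
    using adj_verts[OF assms that]
    by (auto simp: ve_dominates_def closed_neighborhood_def vdom_def adj_def[symmetric])
  then show ?thesis
    unfolding ve_dominating_set_def by (metis assms adj_def edge_cases)
qed

lemma induced_ve_dominating_set_iff:
  assumes G: "simple_graph G" and "S \<subseteq> verts G"
  shows "ve_dominating_set (induced_subgraph G S) D \<longleftrightarrow>
     D \<subseteq> S \<and> (\<forall>x \<in> S. \<forall>y \<in> S. adj G x y \<longrightarrow> (\<exists>v \<in> D. vdom G v x y))"
  unfolding ve_dominating_set_iff[OF simple_induced_subgraph[OF G]]
  using assms(2) by (fastforce simp: vdom_def)

definition butterfly :: "'a graph \<Rightarrow> 'a \<Rightarrow> 'a \<Rightarrow> 'a \<Rightarrow> 'a \<Rightarrow> 'a \<Rightarrow> bool" where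
  "butterfly G z a a' b b' \<longleftrightarrow> two_K2_copy G a a' b b' \<and>
     adj G z a \<and> adj G z a' \<and> adj G z b \<and> adj G z b'"

definition A_join_A :: "'a graph \<Rightarrow> 'a \<Rightarrow> 'a \<Rightarrow> 'a \<Rightarrow> 'a \<Rightarrow> 'a \<Rightarrow> 'a \<Rightarrow> bool" where
  "A_join_A G x y d x' y' d' \<longleftrightarrow> A_copy G x y d \<and> A_copy G x' y' d' \<and>
     (\<forall>p \<in> {x, y, d}. \<forall>q \<in> {x', y', d'}. adj G p q)"

lemma not_well_ve_dominatedI:
  assumes G: "simple_graph G" and "ve_dominating_set G {p}" "adj G x y"
    and qr: "ve_dominating_set G {q, r}"
    and q: "\<not> ve_dominating_set G {q}" and r: "\<not> ve_dominating_set G {r}"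
  shows "\<not> well_ve_dominated G"
proof
  assume "well_ve_dominated G"
  have empty: "\<not> ve_dominating_set G {}" using assms(3) by (auto simp: ve_dominating_set_iff[OF G])
  have "q \<noteq> r" using qr q by auto
  have "minimal_ve_dominating_set G {p}"
    using assms(2) empty by (auto simp: minimal_ve_dominating_set_def dest: subset_singletonD)
  moreover have "D' = {} \<or> D' = {q} \<or> D' = {r}" if "D' \<subset> {q, r}" for D'
    using that by blast
  then have "minimal_ve_dominating_set G {q, r}"
    using qr q r empty by (auto simp: minimal_ve_dominating_set_def)
  ultimately have "card {p} = card {q, r}"
    using \<open>well_ve_dominated G\<close> unfolding well_ve_dominated_def by blast
  then show False using \<open>q \<noteq> r\<close> by simp
qed

lemma butterfly_not_perfect:
  assumes G: "simple_graph G" and B: "butterfly G z a a' b b'"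
  shows "\<not> perfectly_well_ve_dominated G"
proof -
  define S where "S = {z, a, a', b, b'}"
  let ?H = "induced_subgraph G S"
  have SG: "S \<subseteq> verts G"
    using B adj_verts[OF G] by (auto simp: butterfly_def two_K2_copy_def S_def)
  have H: "simple_graph ?H" by (rule simple_induced_subgraph[OF G])
  have e: "adj G a a'" "adj G b b'" "adj G z a" "adj G z a'" "adj G z b" "adj G z b'"
    "\<not> adj G a b" "\<not> adj G a b'" "\<not> adj G a' b" "\<not> adj G a' b'"
    using B by (auto simp: butterfly_def two_K2_copy_def)
  have ne: "a \<noteq> b" "a \<noteq> b'" "b \<noteq> a'" using e by (metis adj_commute)+
  note iff = induced_ve_dominating_set_iff[OF G SG]
  have "\<forall>p \<in> S. z = p \<or> adj G z p" using e by (simp add: S_def)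
  then have "ve_dominating_set ?H {z}" unfolding iff vdom_def by (auto simp: S_def)
  moreover have "adj ?H a a'" using e by (simp add: S_def)
  moreover have "\<forall>p \<in> S. \<exists>v \<in> {a, b}. v = p \<or> adj G v p"
    using e adj_commute[of G z] by (simp add: S_def)
  then have "ve_dominating_set ?H {a, b}" unfolding iff vdom_def unfolding S_def by blast
  moreover have "\<not> vdom G a b b'" "\<not> vdom G b a a'"
    using e ne adj_commute[of G b] by (auto simp: vdom_def)
  then have "\<not> ve_dominating_set ?H {a}" "\<not> ve_dominating_set ?H {b}"
    unfolding iff using e by (auto simp: S_def)
  ultimately have "\<not> well_ve_dominated ?H" by (rule not_well_ve_dominatedI[OF H])
  then show ?thesis using SG by (auto simp: perfectly_well_ve_dominated_def)
qed

lemma A_join_A_not_perfect: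
  assumes G: "simple_graph G" and B: "A_join_A G x y d x' y' d'"
  shows "\<not> perfectly_well_ve_dominated G"
proof -
  define S where "S = {x, y, d, x', y', d'}"
  let ?H = "induced_subgraph G S"
  have e: "adj G x y" "adj G x' y'" "\<not> adj G d x" "\<not> adj G d y" "\<not> adj G d' x'" "\<not> adj G d' y'"
    and c: "\<And>p q. p \<in> {x, y, d} \<Longrightarrow> q \<in> {x', y', d'} \<Longrightarrow> adj G p q \<and> adj G q p"
    using B adj_commute[of G] by (auto simp: A_join_A_def A_copy_def)
  have SG: "S \<subseteq> verts G"
    using B adj_verts[OF G] by (auto simp: A_join_A_def A_copy_def S_def)
  have H: "simple_graph ?H" by (rule simple_induced_subgraph[OF G])
  have ne: "d \<noteq> x" "d \<noteq> y" "d' \<noteq> x'" "d' \<noteq> y'" using e by (metis adj_commute)+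
  note iff = induced_ve_dominating_set_iff[OF G SG]
  have x_near: "\<forall>p \<in> S. p = d \<or> x = p \<or> adj G x p" using e c by (simp add: S_def)
  have "vdom G x p q" if "p \<in> S" "q \<in> S" "adj G p q" for p q
    using x_near that adj_neq[OF G \<open>adj G p q\<close>] unfolding vdom_def by metis
  moreover have "x \<in> S" by (simp add: S_def)
  ultimately have "ve_dominating_set ?H {x}" unfolding iff by blast
  moreover have "adj ?H x y" using e by (simp add: S_def)
  moreover have "\<forall>p \<in> S. \<exists>v \<in> {d, d'}. v = p \<or> adj G v p" using c by (simp add: S_def)
  then have "ve_dominating_set ?H {d, d'}" unfolding iff vdom_def unfolding S_def by blast
  moreover have "\<not> vdom G d x y" "\<not> vdom G d' x' y'" using e ne by (auto simp: vdom_def)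
  then have "\<not> ve_dominating_set ?H {d}" "\<not> ve_dominating_set ?H {d'}"
    unfolding iff using e by (auto simp: S_def)
  ultimately have "\<not> well_ve_dominated ?H" by (rule not_well_ve_dominatedI[OF H])
  then show ?thesis using SG by (auto simp: perfectly_well_ve_dominated_def)
qed


section \<open>Sufficiency of excluding the obstructions\<close>

text \<open>
  In a \<open>P\<^sub>4\<close>-free graph a shortest path has at most two edges, so being at distance at most two
  is the same as lying in the same component. This relation is therefore transitive there
  (\<open>near_trans\<close>), and it stands in for connectedness.
\<close>

definition near :: "'a graph \<Rightarrow> 'a \<Rightarrow> 'a \<Rightarrow> bool" where
  "near G x y \<longleftrightarrow> x = y \<or> adj G x y \<or> (\<exists>z. adj G x z \<and> adj G z y)"

locale P4_free =
  fixes G :: "'a graph"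
  assumes simple: "simple_graph G"
    and P4_free: "\<lbrakk>adj G a b; adj G b c; adj G c d; \<not> adj G a c; \<not> adj G b d\<rbrakk> \<Longrightarrow> a = d \<or> adj G a d"
begin

lemma near_commute: "near G x y \<longleftrightarrow> near G y x"
  unfolding near_def by (metis adj_commute)

lemma near_step: "near G x y \<Longrightarrow> adj G y w \<Longrightarrow> near G x w"
  unfolding near_def by (metis P4_free)

lemma near_trans: "near G x y \<Longrightarrow> near G y w \<Longrightarrow> near G x w"
  using near_step unfolding near_def[of G y w] by blast

lemma vdom_near: "vdom G v x y \<Longrightarrow> adj G x y \<Longrightarrow> near G v x"
  unfolding vdom_def near_def by (metis adj_commute)

text \<open>
  Listing first the endpoint that lies in the closed neighbourhood of \<open>v\<close> saves a case distinction
  for each of the two edges in the proof of \<open>dominated_edges_nested\<close>.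
\<close>

lemma vdom_orient:
  assumes "adj G x y" "vdom G v x y"
  obtains p q where "adj G p q" "v = p \<or> adj G v p" "\<And>u. vdom G u p q \<longleftrightarrow> vdom G u x y"
proof (cases "v = x \<or> adj G v x")
  case True
  then show thesis using that[of x y] assms(1) by blast
next
  case False
  then have "v = y \<or> adj G v y" using assms(2) by (auto simp: vdom_def)
  moreover have "adj G y x" using assms(1) adj_commute by metis
  moreover have "vdom G u y x \<longleftrightarrow> vdom G u x y" for u by (auto simp: vdom_def)
  ultimately show thesis using that by blast
qed

text \<open>
  Suppose \<open>d'\<close> but not \<open>d\<close> dominates an edge \<open>x y\<close>, and \<open>d\<close> but not \<open>d'\<close> dominates an edge
  \<open>x' y'\<close>. If \<open>d\<close> and \<open>d'\<close> are adjacent, repeated use of \<open>P\<^sub>4\<close>-freeness makes \<open>{x, y, d}\<close> completely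
  adjacent to \<open>{x', y', d'}\<close>, and both triples induce \<open>A\<close>. If they are not adjacent, they have a
  common neighbour \<open>z\<close>; then \<open>d\<close> and \<open>d'\<close> have private neighbours, and these form with
  \<open>z\<close> a butterfly.
\<close>

lemma dominated_edges_nested:
  assumes no_B: "\<And>z a a' b b'. \<not> butterfly G z a a' b b'"
    and no_AA: "\<And>x y d x' y' d'. \<not> A_join_A G x y d x' y' d'"
    and near: "near G d d'"
  shows "(\<forall>x y. adj G x y \<longrightarrow> vdom G d x y \<longrightarrow> vdom G d' x y) \<or>
         (\<forall>x y. adj G x y \<longrightarrow> vdom G d' x y \<longrightarrow> vdom G d x y)"
proof (rule ccontr)
  assume "\<not> ?thesis"
  then obtain x0 y0 x0' y0' where
    e: "adj G x0 y0" "vdom G d' x0 y0" "\<not> vdom G d x0 y0" and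
    e': "adj G x0' y0'" "vdom G d x0' y0'" "\<not> vdom G d' x0' y0'" by blast
  obtain x y where xy: "adj G x y" "d' = x \<or> adj G d' x" "\<not> vdom G d x y"
    using e vdom_orient by metis
  obtain x' y' where xy': "adj G x' y'" "d = x' \<or> adj G d x'" "\<not> vdom G d' x' y'"
    using e' vdom_orient by metis
  note n = xy(3)[unfolded vdom_def] xy'(3)[unfolded vdom_def]
  have "d \<noteq> d'" using xy n by (auto simp: vdom_def)
  show False
  proof (cases "adj G d d'")
    case True
    have "adj G d' x" "adj G d x'" using True xy(2) xy'(2) n by (metis adj_commute)+
    note s = adj_commute[of G]
    have xx': "adj G x x'"
      using P4_free[of x d' d x'] True \<open>adj G d' x\<close> \<open>adj G d x'\<close> n s by metis
    have yx': "adj G y x'"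
      using P4_free[of y x x' d] xx' xy(1) \<open>adj G d x'\<close> n s by metis
    have y'x: "adj G y' x"
      using P4_free[of y' x' x d'] xx' xy'(1) \<open>adj G d' x\<close> n s by metis
    have yd': "adj G y d'"
      using P4_free[of y x d' d] True xy(1) \<open>adj G d' x\<close> n s by metis
    have y'd: "adj G y' d"
      using P4_free[of y' x' d d'] True xy'(1) \<open>adj G d x'\<close> n s by metis
    have yy': "adj G y y'"
      using P4_free[of y d' d y'] True yd' y'd n s by metis
    have "A_join_A G x y d x' y' d'"
      unfolding A_join_A_def A_copy_def
      using True xx' yx' y'x yd' y'd yy' \<open>adj G d' x\<close> \<open>adj G d x'\<close> n xy(1) xy'(1) s
        adj_verts[OF simple] by auto
    then show False using no_AA by blast
  next
    case False
    with near \<open>d \<noteq> d'\<close> obtain z where z: "adj G d z" "adj G z d'" by (auto simp: near_def)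
    obtain p where p: "adj G d' p" "\<not> adj G d p" "p \<noteq> d"
      using xy(1,2) n(1) by (metis adj_commute)
    obtain p' where p': "adj G d p'" "\<not> adj G d' p'" "p' \<noteq> d'"
      using xy'(1,2) n(2) by (metis adj_commute)
    note s = adj_commute[of G]
    have pz: "adj G p z" using P4_free[of p d' z d] p z False s by metis
    have p'z: "adj G p' z" using P4_free[of p' d z d'] p' z False s by metis
    have pp': "\<not> adj G p p'" using P4_free[of d' p p' d] p p' False s by metis
    have "butterfly G z d p' d' p"
      unfolding butterfly_def two_K2_copy_def using p p' z pz p'z pp' False s by metis
    then show False using no_B by blast
  qed
qed

text \<open>
  By minimality each vertex of the set has a private edge, dominated by no other vertex of the set.
\<close>

lemma minimal_ve_dominating_setD:
  assumes "minimal_ve_dominating_set G D" "d \<in> D"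
  obtains x y where "adj G x y" "vdom G d x y" "\<And>v. v \<in> D \<Longrightarrow> vdom G v x y \<Longrightarrow> v = d"
proof -
  have D: "ve_dominating_set G D" using assms by (simp add: minimal_ve_dominating_set_def)
  have "\<not> ve_dominating_set G (D - {d})"
    using assms by (auto simp: minimal_ve_dominating_set_def)
  then obtain x y where "adj G x y" "\<And>v. v \<in> D - {d} \<Longrightarrow> \<not> vdom G v x y"
    using D unfolding ve_dominating_set_iff[OF simple] by blast
  then show thesis using that D unfolding ve_dominating_set_iff[OF simple] by blast
qed

text \<open>
  Nestedness excludes private edges for two vertices of one component, so a minimal
  set meets each component at most once. A private edge of \<open>d \<in> D\<close> is dominated by some vertex of
  \<open>D'\<close> in the same component; this choice maps \<open>D\<close> injectively into \<open>D'\<close>, and by symmetry the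
  cardinalities agree.
\<close>

lemma well_ve_dominatedI:
  assumes no_B: "\<And>z a a' b b'. \<not> butterfly G z a a' b b'"
    and no_AA: "\<And>x y d x' y' d'. \<not> A_join_A G x y d x' y' d'"
  shows "well_ve_dominated G"
proof -
  have unique: "d = d'"
    if D: "minimal_ve_dominating_set G D" and d: "d \<in> D" "d' \<in> D" and "near G d d'" for D d d'
    using dominated_edges_nested[OF no_B no_AA \<open>near G d d'\<close>]
      minimal_ve_dominating_setD[OF D d(1)] minimal_ve_dominating_setD[OF D d(2)] d by metis
  have le: "card D \<le> card D'"
    if D: "minimal_ve_dominating_set G D" and D': "minimal_ve_dominating_set G D'" for D D'
  proof -
    have "\<exists>d' \<in> D'. near G d d'" if "d \<in> D" for d
    proof -
      obtain x y where xy: "adj G x y" "vdom G d x y"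
        using minimal_ve_dominating_setD[OF D \<open>d \<in> D\<close>] by metis
      with D' obtain d' where "d' \<in> D'" "vdom G d' x y"
        unfolding minimal_ve_dominating_set_def ve_dominating_set_iff[OF simple] by blast
      then show ?thesis using xy vdom_near near_trans near_commute by blast
    qed
    then obtain f where f: "\<And>d. d \<in> D \<Longrightarrow> f d \<in> D' \<and> near G d (f d)" by metis
    have "inj_on f D"
      using f unique[OF D] near_trans near_commute unfolding inj_on_def by metis
    moreover have "finite D'"
      using D' simple finite_subset
      by (auto simp: minimal_ve_dominating_set_def ve_dominating_set_def simple_graph_def)
    ultimately show ?thesis using f by (intro card_inj_on_le) auto
  qed
  then show ?thesis unfolding well_ve_dominated_def by (meson le_antisym)
qed

end

lemma perfectly_well_ve_dominatedI:
  assumes G: "simple_graph G" "cograph G"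
    and no_B: "\<And>z a a' b b'. \<not> butterfly G z a a' b b'"
    and no_AA: "\<And>x y d x' y' d'. \<not> A_join_A G x y d x' y' d'"
  shows "perfectly_well_ve_dominated G"
  unfolding perfectly_well_ve_dominated_def
proof (intro allI impI)
  fix S
  interpret P4_free "induced_subgraph G S"
  proof
    show "simple_graph (induced_subgraph G S)" by (rule simple_induced_subgraph[OF G(1)])
    show "a = d \<or> adj (induced_subgraph G S) a d"
      if "adj (induced_subgraph G S) a b" "adj (induced_subgraph G S) b c"
        "adj (induced_subgraph G S) c d" "\<not> adj (induced_subgraph G S) a c"
        "\<not> adj (induced_subgraph G S) b d" for a b c d
      using that P4_free_cographD[OF G, of a b c d] by simp
  qed
  show "well_ve_dominated (induced_subgraph G S)"
  proof (rule well_ve_dominatedI)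
    fix z a a' b b'
    show "\<not> butterfly (induced_subgraph G S) z a a' b b'"
      using no_B[of z a a' b b'] by (auto simp: butterfly_def two_K2_copy_def)
  next
    fix x y d x' y' d'
    show "\<not> A_join_A (induced_subgraph G S) x y d x' y' d'"
      using no_AA[of x y d x' y' d'] by (auto simp: A_join_A_def A_copy_def)
  qed
qed


section \<open>Reading adjacency off a cotree\<close>

abbreviation leaves :: "'a cotree \<Rightarrow> 'a set" where
  "leaves t \<equiv> set (leaf_list t)"

lemma leaves_subtree: "u \<in> subtrees t \<Longrightarrow> leaves u \<subseteq> leaves t"
  by (induction t) auto

lemma distinct_leaves_subtree: "u \<in> subtrees t \<Longrightarrow> distinct (leaf_list t) \<Longrightarrow> distinct (leaf_list u)"
  by (induction t) (auto simp: distinct_concat_iff)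

lemma subtrees_self: "t \<in> subtrees t"
  by (cases t) auto

lemma subtrees_trans: "u \<in> subtrees t \<Longrightarrow> v \<in> subtrees u \<Longrightarrow> v \<in> subtrees t"
  by (induction t) auto

lemma leaves_nonempty:
  assumes "\<And>l ts. Node l ts \<in> subtrees t \<Longrightarrow> ts \<noteq> []"
  shows "leaves t \<noteq> {}"
  using assms
proof (induction t)
  case (Node l ts)
  then obtain c where "c \<in> set ts" by fastforce
  with Node have "leaves c \<noteq> {}" by auto
  with \<open>c \<in> set ts\<close> show ?case by auto
qed simp

lemma distinct_concat_disjoint:
  "distinct (concat xss) \<Longrightarrow> i < length xss \<Longrightarrow> j < length xss \<Longrightarrow> i \<noteq> j \<Longrightarrow>
   set (xss ! i) \<inter> set (xss ! j) = {}"
proof (induction xss arbitrary: i j)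
  case (Cons xs xss)
  have "set (xss ! k) \<subseteq> set (concat xss)" if "k < length xss" for k
    using that by (metis UN_upper nth_mem set_concat)
  then have "set xs \<inter> set (xss ! k) = {}" if "k < length xss" for k
    using that Cons.prems(1) by fastforce
  with Cons show ?case by (cases i; cases j) (simp_all add: Int_commute)
qed simp

text \<open>
  Descending from the root while some child still covers \<open>S\<close> ends at the lowest node covering
  \<open>S\<close>; it is not a leaf because \<open>S\<close> has two elements.
\<close>

lemma separating_node:
  assumes "p \<in> S" "q \<in> S" "p \<noteq> q" "S \<subseteq> leaves t"
  shows "\<exists>l ts. Node l ts \<in> subtrees t \<and> S \<subseteq> leaves (Node l ts) \<and>
           (\<forall>c \<in> set ts. \<not> S \<subseteq> leaves c)"
  using assms(4)
proof (induction t)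
  case (Leaf a)
  then show ?case using assms(1-3) by auto
next
  case (Node l ts)
  show ?case
  proof (cases "\<exists>c \<in> set ts. S \<subseteq> leaves c")
    case True
    then obtain c where c: "c \<in> set ts" "S \<subseteq> leaves c" by blast
    then have "subtrees c \<subseteq> subtrees (Node l ts)" by auto
    then show ?thesis using Node.IH[OF c] by blast
  next
    case False
    then show ?thesis using Node.prems by (metis subtrees_self)
  qed
qed

locale reduced_cotree_of =
  fixes G :: "'a graph" and T :: "'a cotree"
  assumes simple: "simple_graph G" and reduced: "reduced_cotree T G"
begin

lemma verts_node_graph: "u \<in> subtrees T \<Longrightarrow> verts (node_graph G u) = leaves u"
  using leaves_subtree[of u T] reduced
  by (auto simp: node_graph_def reduced_cotree_def is_cotree_def)

lemma child_subtree: "Node l cs \<in> subtrees T \<Longrightarrow> c \<in> set cs \<Longrightarrow> c \<in> subtrees T"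
  using subtrees_trans[of "Node l cs" T c] subtrees_self[of c] by auto

lemma adj_node_graph: "adj (node_graph G u) x y \<longleftrightarrow> adj G x y \<and> x \<in> leaves u \<and> y \<in> leaves u"
  by (simp add: node_graph_def)

lemma simple_node_graph: "simple_graph (node_graph G u)"
  unfolding node_graph_def by (rule simple_induced_subgraph[OF simple])

lemma children_disjoint:
  assumes "Node l cs \<in> subtrees T" "i < length cs" "j < length cs" "i \<noteq> j"
  shows "leaves (cs ! i) \<inter> leaves (cs ! j) = {}"
proof -
  have "distinct (concat (map leaf_list cs))"
    using distinct_leaves_subtree[OF assms(1)] reduced
    by (simp add: reduced_cotree_def is_cotree_def)
  then show ?thesis using distinct_concat_disjoint[of "map leaf_list cs" i j] assms(2-4) by simp
qed

lemma join_adj: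
  assumes "Node JoinNode cs \<in> subtrees T" "i < length cs" "j < length cs" "i \<noteq> j"
    and "x \<in> leaves (cs ! i)" "y \<in> leaves (cs ! j)"
  shows "adj G x y"
proof -
  have eq: "node_graph G (Node JoinNode cs) = join_graphs (map (node_graph G) cs)"
    using assms(1) reduced by (simp add: reduced_cotree_def is_cotree_def)
  have "x \<in> verts (map (node_graph G) cs ! i)" "y \<in> verts (map (node_graph G) cs ! j)"
    using assms child_subtree verts_node_graph by auto
  then have "adj (join_graphs (map (node_graph G) cs)) x y"
    using assms(2-4) unfolding adj_def join_graphs_def graph.sel length_map by blast
  then have "adj (node_graph G (Node JoinNode cs)) x y" using eq by simp
  then show ?thesis by (simp add: adj_node_graph)
qed

lemma union_adj:
  assumes "Node UnionNode cs \<in> subtrees T"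
    and "x \<in> leaves (Node UnionNode cs)" "y \<in> leaves (Node UnionNode cs)" "adj G x y"
  shows "\<exists>c \<in> set cs. x \<in> leaves c \<and> y \<in> leaves c"
proof -
  have eq: "node_graph G (Node UnionNode cs) = union_graphs (map (node_graph G) cs)"
    using assms(1) reduced by (simp add: reduced_cotree_def is_cotree_def)
  have "adj (node_graph G (Node UnionNode cs)) x y" using assms by (simp add: adj_node_graph)
  then have "\<exists>c \<in> set cs. adj (node_graph G c) x y"
    unfolding eq by (auto simp: adj_def union_graphs_def)
  then show ?thesis by (auto simp: adj_node_graph)
qed

text \<open>
  Between different children all pairs are adjacent at a join node, and none is at a union node.
  So paths in the complement (join) or in the graph (union) stay within one child.
\<close>

lemma same_child:
  assumes u: "Node l cs \<in> subtrees T"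
    and x: "x \<in> leaves c" "c \<in> set cs" and y: "y \<in> leaves (Node l cs)"
    and xy: "if l = JoinNode then \<not> adj G x y else adj G x y"
  shows "y \<in> leaves c"
proof -
  obtain i where i: "i < length cs" "c = cs ! i" using x(2) by (auto simp: in_set_conv_nth)
  obtain j where j: "j < length cs" "y \<in> leaves (cs ! j)"
    using y by simp (metis in_set_conv_nth)
  show ?thesis
  proof (cases l)
    case JoinNode
    then show ?thesis using join_adj[of cs i j x y] u x xy i j by auto
  next
    case UnionNode
    have "x \<in> leaves (Node l cs)" using x by auto
    then obtain c' where "c' \<in> set cs" "x \<in> leaves c'" "y \<in> leaves c'"
      using union_adj[of cs x y] u y xy UnionNode by auto
    then obtain k where k: "k < length cs" "x \<in> leaves (cs ! k)" "y \<in> leaves (cs ! k)"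
      by (metis in_set_conv_nth)
    then have "k = i" using children_disjoint[OF u k(1) i(1)] x i by blast
    then show ?thesis using k i by simp
  qed
qed

lemma separating_node_verts:
  assumes "S \<subseteq> verts G" "p \<noteq> q" "p \<in> S" "q \<in> S"
  obtains l cs where "Node l cs \<in> subtrees T" "S \<subseteq> leaves (Node l cs)"
    "\<And>c. c \<in> set cs \<Longrightarrow> \<not> S \<subseteq> leaves c"
proof -
  have "S \<subseteq> leaves T" using assms(1) reduced by (simp add: reduced_cotree_def is_cotree_def)
  then show thesis using separating_node[OF assms(3,4,2)] that by metis
qed

lemma join_node_butterfly:
  assumes u: "Node JoinNode cs \<in> subtrees T" and v: "v \<in> set cs"
    and "contains_induced (node_graph G v) two_K2"
  shows "\<exists>z a a' b b'. butterfly G z a a' b b'"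
proof -
  from assms(3) obtain a a' b b' where c: "two_K2_copy (node_graph G v) a a' b b'"
    by (auto simp: contains_two_K2_iff[OF simple_node_graph])
  obtain i where i: "i < length cs" "v = cs ! i" using v by (auto simp: in_set_conv_nth)
  have "length cs \<ge> 2" using u reduced by (auto simp: reduced_cotree_def)
  then obtain j where j: "j < length cs" "j \<noteq> i"
    by (metis One_nat_def Suc_1 Suc_le_eq less_2_cases_iff less_trans zero_neq_one zero_less_one)
  have "cs ! j \<in> subtrees T" using child_subtree[OF u] j by simp
  then have "leaves (cs ! j) \<noteq> {}"
    using reduced subtrees_trans[of "cs ! j" T] unfolding reduced_cotree_def is_cotree_def
    by (intro leaves_nonempty) blast
  then obtain z where z: "z \<in> leaves (cs ! j)" by (metis ex_in_conv)
  have "adj G z p" if "p \<in> leaves v" for p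
    using join_adj[OF u j(1) i(1) j(2) z] that i(2) by blast
  then have "butterfly G z a a' b b'"
    using c by (auto simp: butterfly_def two_K2_copy_def adj_node_graph)
  then show ?thesis by blast
qed

lemma join_node_A_join_A:
  assumes u: "Node JoinNode cs \<in> subtrees T" and v: "v \<in> set cs" "w \<in> set cs" "v \<noteq> w"
    and A: "contains_induced (node_graph G v) graph_A" "contains_induced (node_graph G w) graph_A"
  shows "\<exists>x y d x' y' d'. A_join_A G x y d x' y' d'"
proof -
  from A obtain x y d x' y' d' where
    c: "A_copy (node_graph G v) x y d" "A_copy (node_graph G w) x' y' d'"
    by (auto simp: contains_graph_A_iff[OF simple_node_graph])
  then have l: "{x, y, d} \<subseteq> leaves v" "{x', y', d'} \<subseteq> leaves w"
    using verts_node_graph child_subtree[OF u] v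
    by (auto simp: A_copy_def adj_node_graph)
  obtain i j where "i < length cs" "v = cs ! i" "j < length cs" "w = cs ! j"
    using v by (auto simp: in_set_conv_nth)
  then have "adj G p q" if "p \<in> leaves v" "q \<in> leaves w" for p q
    using join_adj[OF u, of i j p q] that v(3) by auto
  moreover have "A_copy G x y d" "A_copy G x' y' d'"
    using c l by (auto simp: A_copy_def adj_node_graph) (auto simp: node_graph_def)
  ultimately have "A_join_A G x y d x' y' d'" using l by (auto simp: A_join_A_def)
  then show ?thesis by blast
qed

text \<open>
  At a union node the butterfly would stay with its centre \<open>z\<close> inside one child. At a join
  node the four-cycle \<open>a b a' b'\<close> of the complement keeps its copy of \<open>2K\<^sub>2\<close> in one child.
\<close>

lemma butterfly_join_node:
  assumes B: "butterfly G z a a' b b'"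
  shows "\<exists>cs. Node JoinNode cs \<in> subtrees T \<and>
           (\<exists>v \<in> set cs. contains_induced (node_graph G v) two_K2)"
proof -
  have e: "adj G a a'" "adj G b b'" "adj G z a" "adj G z a'" "adj G z b" "adj G z b'"
    "\<not> adj G a b" "\<not> adj G a b'" "\<not> adj G a' b" "\<not> adj G a' b'"
    using B by (auto simp: butterfly_def two_K2_copy_def)
  let ?S = "{z, a, a', b, b'}"
  have "?S \<subseteq> verts G" using e adj_verts[OF simple] by auto
  moreover have "z \<noteq> a" using e adj_neq[OF simple] by blast
  ultimately obtain l cs where u: "Node l cs \<in> subtrees T" and S: "?S \<subseteq> leaves (Node l cs)"
    and split: "\<And>c. c \<in> set cs \<Longrightarrow> \<not> ?S \<subseteq> leaves c"
    by (rule separating_node_verts[of ?S z a]) blast+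
  show ?thesis
  proof (cases l)
    case UnionNode
    obtain c where c: "c \<in> set cs" "z \<in> leaves c" using S by auto
    have "?S \<subseteq> leaves c"
      using same_child[OF u c(2,1)] S c e UnionNode by auto
    then show ?thesis using split c by blast
  next
    case JoinNode
    obtain c where c: "c \<in> set cs" "a \<in> leaves c" using S by auto
    have b: "b \<in> leaves c" "b' \<in> leaves c"
      using same_child[OF u c(2,1)] S e JoinNode by auto
    have "a' \<in> leaves c"
      using same_child[OF u b(1) c(1), of a'] S e JoinNode adj_commute[of G] by auto
    then have "two_K2_copy (node_graph G c) a a' b b'"
      using b c e by (simp add: two_K2_copy_def adj_node_graph)
    then have "contains_induced (node_graph G c) two_K2"
      using contains_two_K2_iff[OF simple_node_graph] by blast
    then show ?thesis using u c JoinNode by blast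
  qed
qed

text \<open>
  At a union node connectedness would put all six vertices into one child. At a join node each copy of
  \<open>A\<close> stays in one child, as its complement is a path, and the two children
  differ because no child covers everything.
\<close>

lemma A_join_A_join_node:
  assumes B: "A_join_A G x y d x' y' d'"
  shows "\<exists>cs. Node JoinNode cs \<in> subtrees T \<and>
           (\<exists>v \<in> set cs. \<exists>w \<in> set cs. v \<noteq> w \<and>
              contains_induced (node_graph G v) graph_A \<and>
              contains_induced (node_graph G w) graph_A)"
proof -
  have e: "adj G x y" "adj G x' y'" "\<not> adj G d x" "\<not> adj G d y" "\<not> adj G d' x'" "\<not> adj G d' y'"
    and cr: "\<And>p q. p \<in> {x, y, d} \<Longrightarrow> q \<in> {x', y', d'} \<Longrightarrow> adj G p q \<and> adj G q p"
    using B adj_commute[of G] by (auto simp: A_join_A_def A_copy_def)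
  let ?S = "{x, y, d, x', y', d'}"
  have "?S \<subseteq> verts G" using B adj_verts[OF simple] by (auto simp: A_join_A_def A_copy_def)
  moreover have "x \<noteq> y" using e adj_neq[OF simple] by blast
  ultimately obtain l cs where u: "Node l cs \<in> subtrees T" and S: "?S \<subseteq> leaves (Node l cs)"
    and split: "\<And>c. c \<in> set cs \<Longrightarrow> \<not> ?S \<subseteq> leaves c"
    by (rule separating_node_verts[of ?S x y]) blast+
  show ?thesis
  proof (cases l)
    case UnionNode
    obtain c where c: "c \<in> set cs" "x \<in> leaves c" using S by auto
    have "adj G x x'" "adj G x y'" "adj G x d'" "adj G x' y" "adj G x' d" using cr by blast+
    note e' = this
    have 1: "{x', y', d'} \<subseteq> leaves c"
      using same_child[OF u c(2,1)] S e' UnionNode by auto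
    then have x': "x' \<in> leaves c" by simp
    have "{y, d} \<subseteq> leaves c"
      using same_child[OF u x' c(1)] S e' UnionNode by auto
    then show ?thesis using split[OF c(1)] 1 c(2) by blast
  next
    case JoinNode
    obtain v where v: "v \<in> set cs" "d \<in> leaves v" using S by auto
    obtain w where w: "w \<in> set cs" "d' \<in> leaves w" using S by auto
    have vl: "{x, y} \<subseteq> leaves v" using same_child[OF u v(2,1)] S e JoinNode by auto
    have wl: "{x', y'} \<subseteq> leaves w" using same_child[OF u w(2,1)] S e JoinNode by auto
    have "v \<noteq> w" using split[OF v(1)] v w vl wl by blast
    have "A_copy (node_graph G v) x y d" "A_copy (node_graph G w) x' y' d'"
      using v w vl wl e verts_node_graph[OF child_subtree[OF u]]
      by (simp_all add: A_copy_def adj_node_graph)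
    then have "contains_induced (node_graph G v) graph_A"
      "contains_induced (node_graph G w) graph_A"
      using contains_graph_A_iff[OF simple_node_graph] by blast+
    then show ?thesis using u v w \<open>v \<noteq> w\<close> JoinNode by blast
  qed
qed

end

theorem theorem10:
  fixes G :: "'a graph" and T :: "'a cotree"
  assumes "simple_graph G"
    and "cograph G"
    and "reduced_cotree T G"
  shows "perfectly_well_ve_dominated G \<longleftrightarrow>
    (\<forall>cs. Node JoinNode cs \<in> subtrees T \<longrightarrow>
       (\<forall>v \<in> set cs. induced_free two_K2 (node_graph G v)) \<and>
       (\<forall>v \<in> set cs. \<forall>w \<in> set cs.
          contains_induced (node_graph G v) graph_A \<longrightarrow>
          contains_induced (node_graph G w) graph_A \<longrightarrow> v = w))"
    (is "_ \<longleftrightarrow> ?C")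
proof -
  interpret reduced_cotree_of G T using assms by unfold_locales
  show ?thesis
  proof
    assume P: "perfectly_well_ve_dominated G"
    have "\<nexists>z a a' b b'. butterfly G z a a' b b'"
      using P butterfly_not_perfect[OF simple] by blast
    moreover have "\<nexists>x y d x' y' d'. A_join_A G x y d x' y' d'"
      using P A_join_A_not_perfect[OF simple] by blast
    ultimately show ?C
      unfolding induced_free_def using join_node_butterfly join_node_A_join_A by metis
  next
    assume C: ?C
    show "perfectly_well_ve_dominated G"
    proof (rule perfectly_well_ve_dominatedI[OF assms(1,2)])
      show "\<not> butterfly G z a a' b b'" for z a a' b b'
        using C butterfly_join_node unfolding induced_free_def by metis
      show "\<not> A_join_A G x y d x' y' d'" for x y d x' y' d'
        using C A_join_A_join_node by metis
    qed
  qed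
qed

end
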